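(* $G_n$ is perfect if and only if $n$ is even, or $n = p^m$ (a power of $p$) for $p \equiv 3 \pmod 4$ prime.
   Context: For an integer $n \ge 1$, $\mathbb{Z}_n$ is the ring of integers modulo $n$ and $\mathbb{Z}_n^\times$ its group of multiplicative units. Let $Q_n = \{u^2 : u \in \mathbb{Z}_n^\times\}$ and $T_n = \pm Q_n = \{\pm u^2 : u \in \mathbb{Z}_n^\times\}$. The (undirected) quadratic unitary Cayley graph $G_n = \mathrm{Cay}(\mathbb{Z}_n, T_n)$ is the graph with vertex set $\mathbb{Z}_n$ in which $a,b$ are adjacent if and only if $a-b \in T_n$. A graph $G$ is perfect if, for every induced subgraph $H$ of $G$, the size of the maximum clique in $H$ is equal to the chromatic number of $H$. *)

theory Defs
  imports "HOL-Algebra.IntRing" "HOL-Library.Ramsey" "HOL-Computational_Algebra.Primes"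
begin

text \<open>
  Graphs are undirected and simple, and are given by a vertex set \<open>V\<close> and a set \<open>E\<close> of
  two-element subsets of \<open>V\<close>, as expected by \<^const>\<open>Ramsey.clique\<close>.
\<close>

definition induced_edges :: "'a set \<Rightarrow> 'a set set \<Rightarrow> 'a set set" where
  "induced_edges W E = {e \<in> E. e \<subseteq> W}"

definition clique_number :: "'a set \<Rightarrow> 'a set set \<Rightarrow> nat" where
  "clique_number V E = Max {card K | K. K \<subseteq> V \<and> clique K E}"

definition proper_colouring :: "'a set \<Rightarrow> 'a set set \<Rightarrow> nat \<Rightarrow> ('a \<Rightarrow> nat) \<Rightarrow> bool" where
  "proper_colouring V E k f \<longleftrightarrow>
     (\<forall>v\<in>V. f v < k) \<and> (\<forall>v\<in>V. \<forall>w\<in>V. {v, w} \<in> E \<longrightarrow> f v \<noteq> f w)"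

definition chromatic_number :: "'a set \<Rightarrow> 'a set set \<Rightarrow> nat" where
  "chromatic_number V E = (LEAST k. \<exists>f. proper_colouring V E k f)"

definition perfect_graph :: "'a set \<Rightarrow> 'a set set \<Rightarrow> bool" where
  "perfect_graph V E \<longleftrightarrow>
     (\<forall>W. W \<subseteq> V \<longrightarrow>
        clique_number W (induced_edges W E) = chromatic_number W (induced_edges W E))"

text \<open>
  The ring of integers modulo \<open>n\<close> is the quotient ring \<^const>\<open>ZFact\<close>. Unlike
  \<open>residue_ring\<close> from \<open>HOL-Number_Theory\<close>, whose unit element is \<open>1\<close> for every modulus, it is
  correct also for \<open>n = 1\<close>.
\<close>

abbreviation Zmod :: "nat \<Rightarrow> int set ring" where
  "Zmod n \<equiv> ZFact (int n)"

definition unit_squares :: "nat \<Rightarrow> int set set" where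
  "unit_squares n = {u [^]\<^bsub>Zmod n\<^esub> (2::nat) | u. u \<in> Units (Zmod n)}"

definition pm_unit_squares :: "nat \<Rightarrow> int set set" where
  "pm_unit_squares n = unit_squares n \<union> {\<ominus>\<^bsub>Zmod n\<^esub> q | q. q \<in> unit_squares n}"

text \<open>
  The condition \<open>a \<noteq> b\<close> matters only for \<open>n = 1\<close>, where \<open>0\<close> is a unit: it discards the loop,
  so that the graph is a single vertex. For \<open>n > 1\<close> no element of the connection set is zero.
\<close>

definition quc_edges :: "nat \<Rightarrow> int set set set" where
  "quc_edges n = {{a, b} | a b. a \<in> carrier (Zmod n) \<and> b \<in> carrier (Zmod n) \<and>
     a \<noteq> b \<and> a \<ominus>\<^bsub>Zmod n\<^esub> b \<in> pm_unit_squares n}"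

end

(*
  For even n the graph is bipartite, and for n = p^m with p = 3 (mod 4) every unit is plus or
  minus a square, so the graph is complete multipartite with parts the classes modulo p.

  For the converse, by Hensel lifting and the Chinese remainder theorem being a unit square is a
  condition modulo each prime factor. If 5 divides n, then 0, ..., 4 induce a 5-cycle. If n = p^m
  with p = 1 (mod 4), then 0, ..., p - 1 induce a self-complementary vertex-transitive (Paley) graph
  on p vertices, and p is not a square. In all other cases n splits into coprime factors with a
  prime 1 modulo 4 in one of them, or with primes 3 modulo 4 in both, and suitable coordinates
  modulo the two factors give a closed walk of length 7 in a triangle-free induced subgraph, which
  is therefore not 2-colourable.
*)

theory Submission
  imports "HOL-Number_Theory.Euler_Criterion" Defs
begin

section \<open>Clique and chromatic numbers of general graphs\<close>

lemma clique_colouring_card_le: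
  assumes "finite K" "K \<subseteq> W" "clique K (induced_edges W E)"
    and "proper_colouring W (induced_edges W E) k f"
  shows "card K \<le> k"
proof -
  have "inj_on f K"
    using assms(2-4) unfolding clique_def proper_colouring_def by (intro inj_onI) (meson subsetD)
  moreover have "f ` K \<subseteq> {..<k}"
    using assms by (auto simp: proper_colouring_def)
  ultimately show ?thesis
    using card_inj_on_le[of f K "{..<k}"] by auto
qed

text \<open>A clique and a proper colouring of equal size certify both numbers at once: no clique
  exceeds the number of colours of a proper colouring, so the clique is maximum and the colouring
  optimal.\<close>

lemma perfect_graphI:
  assumes "finite V"
    and "\<And>W. W \<subseteq> V \<Longrightarrow> \<exists>K f. K \<subseteq> W \<and> clique K (induced_edges W E) \<and>
           proper_colouring W (induced_edges W E) (card K) f"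
  shows "perfect_graph V E"
  unfolding perfect_graph_def
proof (intro allI impI)
  fix W assume W: "W \<subseteq> V"
  let ?E = "induced_edges W E"
  obtain K f where K: "K \<subseteq> W" "clique K ?E" "proper_colouring W ?E (card K) f"
    using assms(2)[OF W] by blast
  have fin: "finite W" using W assms(1) by (rule finite_subset)
  have "clique_number W ?E = card K"
    unfolding clique_number_def
  proof (rule Max_eqI)
    show "finite {card K | K. K \<subseteq> W \<and> clique K ?E}"
      by (rule finite_subset[of _ "card ` Pow W"]) (use fin in auto)
    show "y \<le> card K" if "y \<in> {card K | K. K \<subseteq> W \<and> clique K ?E}" for y
      using that clique_colouring_card_le[OF _ _ _ K(3)] finite_subset[OF _ fin] by blast
  qed (use K in blast)
  moreover have "chromatic_number W ?E = card K"
    unfolding chromatic_number_def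
  proof (rule Least_equality)
    show "card K \<le> k" if "\<exists>f. proper_colouring W ?E k f" for k
      using that clique_colouring_card_le[OF _ K(1,2)] finite_subset[OF K(1) fin] by blast
  qed (use K in blast)
  ultimately show "clique_number W ?E = chromatic_number W ?E" by simp
qed

text \<open>Unfolds perfection on \<open>W\<close> into a maximum clique and an optimal colouring.
  Absence of loops guarantees that some proper colouring exists, so that the \<open>LEAST\<close> in
  \<open>chromatic_number\<close> is attained.\<close>

lemma perfect_graphE:
  assumes "perfect_graph V E" "finite W" "W \<subseteq> V" "\<And>v. v \<in> V \<Longrightarrow> {v} \<notin> E"
  obtains K f where "K \<subseteq> W" "clique K E" "proper_colouring W E (card K) f"
    "\<And>K'. K' \<subseteq> W \<Longrightarrow> clique K' E \<Longrightarrow> card K' \<le> card K"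
proof -
  let ?E = "induced_edges W E"
  let ?C = "{card K | K. K \<subseteq> W \<and> clique K ?E}"
  have cl: "clique K ?E \<longleftrightarrow> clique K E" if "K \<subseteq> W" for K
    using that by (auto simp: clique_def induced_edges_def)
  have col: "proper_colouring W ?E k f \<longleftrightarrow> proper_colouring W E k f" for k f
    by (auto simp: proper_colouring_def induced_edges_def)
  have fin: "finite ?C"
    by (rule finite_subset[of _ "card ` Pow W"]) (use assms in auto)
  have "Max ?C \<in> ?C"
    by (rule Max_in[OF fin]) (auto intro: exI[of _ "{}"])
  then obtain K where K: "K \<subseteq> W" "clique K E" "Max ?C = card K"
    using cl by auto
  \<comment> \<open>Giving every vertex its own colour is proper in a loopless graph.\<close>
  obtain g :: "_ \<Rightarrow> nat" where g: "bij_betw g W {..<card W}"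
    using ex_bij_betw_finite_nat[OF assms(2)] atLeast0LessThan by metis
  have "proper_colouring W E (card W) g"
    unfolding proper_colouring_def
  proof (intro conjI ballI impI)
    fix v assume "v \<in> W" thus "g v < card W" using g by (auto simp: bij_betw_def)
  next
    fix v w assume vw: "v \<in> W" "w \<in> W" "{v, w} \<in> E"
    hence "v \<noteq> w" using assms(3,4) by auto
    thus "g v \<noteq> g w" using g vw by (auto simp: bij_betw_def inj_on_def)
  qed
  hence "\<exists>k f. proper_colouring W ?E k f" using col by blast
  hence "\<exists>f. proper_colouring W ?E (chromatic_number W ?E) f"
    unfolding chromatic_number_def by (rule LeastI_ex)
  moreover have "chromatic_number W ?E = card K"
    using assms(1,3) K(3) unfolding perfect_graph_def clique_number_def by simp
  ultimately obtain f where "proper_colouring W E (card K) f"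
    using col by auto
  moreover have "card K' \<le> card K" if "K' \<subseteq> W" "clique K' E" for K'
    using Max_ge[OF fin, of "card K'"] that cl K(3) by auto
  ultimately show ?thesis using K that by blast
qed

lemma complete_multipartite_perfect:
  assumes "finite V" and E: "\<And>v w. v \<in> V \<Longrightarrow> w \<in> V \<Longrightarrow> {v, w} \<in> E \<longleftrightarrow> c v \<noteq> c w"
  shows "perfect_graph V E"
proof (rule perfect_graphI[OF assms(1)])
  fix W assume W: "W \<subseteq> V"
  \<comment> \<open>\<open>K\<close> picks one vertex from each class that meets \<open>W\<close>;
    numbering these classes gives a colouring with \<open>card K\<close> colours.\<close>
  obtain K where K: "K \<subseteq> W" "c ` K = c ` W" "inj_on c K"
    by (metis subset_image_inj order_refl)
  have fin: "finite K" "finite (c ` W)"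
    using K W assms(1) by (auto intro: finite_subset)
  obtain g :: "_ \<Rightarrow> nat" where g: "bij_betw g (c ` W) {..<card (c ` W)}"
    using ex_bij_betw_finite_nat[OF fin(2)] atLeast0LessThan by metis
  have card: "card (c ` W) = card K"
    using K by (metis card_image)
  have "clique K (induced_edges W E)"
    unfolding clique_def induced_edges_def
  proof (intro ballI impI CollectI conjI)
    fix v w assume vw: "v \<in> K" "w \<in> K" "v \<noteq> w"
    hence "c v \<noteq> c w" using K(3) by (meson inj_onD)
    thus "{v, w} \<in> E" using E vw K(1) W by (meson subsetD)
    show "{v, w} \<subseteq> W" using vw K(1) by blast
  qed
  moreover have "proper_colouring W (induced_edges W E) (card K) (g \<circ> c)"
    unfolding proper_colouring_def
  proof (intro conjI ballI impI)
    fix v assume "v \<in> W" thus "(g \<circ> c) v < card K" using g card by (auto simp: bij_betw_def)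
  next
    fix v w assume vw: "v \<in> W" "w \<in> W" "{v, w} \<in> induced_edges W E"
    hence "c v \<noteq> c w" using E W by (auto simp: induced_edges_def)
    thus "(g \<circ> c) v \<noteq> (g \<circ> c) w" using g vw by (auto simp: bij_betw_def inj_on_def)
  qed
  ultimately show "\<exists>K f. K \<subseteq> W \<and> clique K (induced_edges W E) \<and>
           proper_colouring W (induced_edges W E) (card K) f"
    using K by blast
qed

text \<open>The certifying clique is an edge, a single vertex or the empty set, according to whether
  \<open>W\<close> contains an edge, is nonempty without edges, or is empty.\<close>

lemma bipartite_perfect:
  assumes "finite V" and E: "\<And>v w. v \<in> V \<Longrightarrow> w \<in> V \<Longrightarrow> {v, w} \<in> E \<Longrightarrow> c v \<noteq> (c w :: bool)"
  shows "perfect_graph V E"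
proof (rule perfect_graphI[OF assms(1)])
  fix W assume W: "W \<subseteq> V"
  let ?E = "induced_edges W E"
  show "\<exists>K f. K \<subseteq> W \<and> clique K ?E \<and> proper_colouring W ?E (card K) f"
  proof (cases "\<exists>v\<in>W. \<exists>w\<in>W. {v, w} \<in> E")
    case True
    then obtain v w where vw: "v \<in> W" "w \<in> W" "{v, w} \<in> E" by blast
    have "v \<noteq> w" using E[of v w] vw W by auto
    have "clique {v, w} ?E"
      using vw by (auto simp: clique_def induced_edges_def insert_commute)
    moreover have "proper_colouring W ?E (card {v, w}) (of_bool \<circ> c)"
      using \<open>v \<noteq> w\<close> E W by (auto simp: proper_colouring_def induced_edges_def)
    ultimately show ?thesis using vw by (intro exI[of _ "{v, w}"]) blast
  next
    case no_edge: False
    show ?thesis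
    proof (cases "W = {}")
      case True
      thus ?thesis by (auto simp: proper_colouring_def intro!: exI[of _ "{}"])
    next
      case False
      then obtain v where "v \<in> W" by blast
      hence "clique {v} ?E" "proper_colouring W ?E (card {v}) (\<lambda>_. 0)"
        using no_edge by (auto simp: clique_def proper_colouring_def induced_edges_def)
      thus ?thesis using \<open>v \<in> W\<close> by (intro exI[of _ "{v}"]) blast
    qed
  qed
qed

text \<open>
  The hypotheses say that deleting \<open>r\<close> leaves a bipartite graph and that \<open>r\<close> lies in no triangle.
\<close>

lemma perfect_graph_near_bipartite:
  assumes "perfect_graph V E" "\<And>v. v \<in> V \<Longrightarrow> {v} \<notin> E"
    and fin: "finite A" "finite B" and sub: "insert r (A \<union> B) \<subseteq> V"
    and indep: "indep A E" "indep B E"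
    and r: "\<And>x. x \<in> A \<Longrightarrow> {r, x} \<in> E \<Longrightarrow> x = a" "\<And>x. x \<in> B \<Longrightarrow> {r, x} \<in> E \<Longrightarrow> x = b"
    and ab: "{a, b} \<notin> E"
  obtains f :: "_ \<Rightarrow> bool" where
    "\<And>v w. v \<in> insert r (A \<union> B) \<Longrightarrow> w \<in> insert r (A \<union> B) \<Longrightarrow> {v, w} \<in> E \<Longrightarrow> f v \<noteq> f w"
proof -
  let ?W = "insert r (A \<union> B)"
  obtain K f where K: "K \<subseteq> ?W" "clique K E" "proper_colouring ?W E (card K) f"
    using perfect_graphE[OF assms(1) _ sub assms(2)] fin by (metis finite_Un finite_insert)
  have one: "card S \<le> 1" if S: "S \<subseteq> K" "indep S E" for S
  proof (rule ccontr)
    assume "\<not> card S \<le> 1"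
    then obtain x y where "x \<in> S" "y \<in> S" "x \<noteq> y"
      by (metis card_le_Suc0_iff_eq card.infinite One_nat_def zero_le)
    thus False using S K(2) by (metis clique_def indep_def subsetD)
  qed
  have finK: "finite K" using K(1) fin by (meson finite_Un finite_insert finite_subset)
  have KA: "card (K \<inter> A) \<le> 1"
    by (rule one) (use indep in \<open>auto simp: indep_def\<close>)
  have KB: "card (K \<inter> B) \<le> 1"
    by (rule one) (use indep in \<open>auto simp: indep_def\<close>)
  \<comment> \<open>A clique has at most one vertex in each of \<open>A\<close> and
    \<open>B\<close>. If it also contains \<open>r\<close> outside both, its other vertices lie in
    \<open>{a, b}\<close>, which is not an edge. So two colours suffice, and being coloured
    \<open>0\<close> separates them.\<close>
  have "card K \<le> 2"
  proof (cases "r \<in> K - (A \<union> B)")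
    case False
    hence "K = (K \<inter> A) \<union> (K \<inter> B)" using K(1) by auto
    thus ?thesis using KA KB card_Un_le[of "K \<inter> A" "K \<inter> B"] by simp
  next
    case True
    have a: "x = a" if "x \<in> K \<inter> A" for x
      using that True K(2) r(1) by (metis DiffE IntE UnCI clique_def)
    have b: "x = b" if "x \<in> K \<inter> B" for x
      using that True K(2) r(2) by (metis DiffE IntE UnCI clique_def)
    have "card (K - {r}) \<le> 1"
    proof (rule one)
      have "{a, b} = {b, a}" by auto
      moreover have "x = a \<and> a \<in> A \<or> x = b \<and> b \<in> B" if "x \<in> K - {r}" for x
        using that K(1) a b by blast
      ultimately show "indep (K - {r}) E"
        using ab unfolding indep_def by metis
    qed auto
    thus ?thesis using True finK by (simp add: card_Diff_singleton)
  qed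
  hence "(f v = 0) \<noteq> (f w = 0)" if "v \<in> ?W" "w \<in> ?W" "{v, w} \<in> E" for v w
  proof -
    have "f v < card K" "f w < card K" "f v \<noteq> f w"
      using K(3) that unfolding proper_colouring_def by auto
    thus ?thesis using \<open>card K \<le> 2\<close> by auto
  qed
  thus ?thesis using that[of "\<lambda>v. f v = 0"] by blast
qed

section \<open>Unit squares and adjacency on integer representatives\<close>

text \<open>The image of \<open>t\<close> modulo \<open>n\<close> is the square of a unit. For
  \<open>n = 1\<close> this holds for every \<open>t\<close>, including \<open>0\<close>.\<close>

definition usq :: "int \<Rightarrow> int \<Rightarrow> bool" where
  "usq n t \<longleftrightarrow> (\<exists>u. coprime u n \<and> [u\<^sup>2 = t] (mod n))"

lemma usq_cong: "[s = t] (mod n) \<Longrightarrow> usq n s \<longleftrightarrow> usq n t"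
  by (simp add: usq_def cong_def)

definition quc_adj :: "nat \<Rightarrow> int \<Rightarrow> int \<Rightarrow> bool" where
  "quc_adj n a b \<longleftrightarrow> \<not> [a = b] (mod int n) \<and> (usq n (a - b) \<or> usq n (b - a))"

lemma ZMod_ring_hom: "ring_hom_cring \<Z> (ZFact k) (ZMod k)"
proof -
  interpret ideal "Idl\<^bsub>\<Z>\<^esub> {k}" \<Z>
    by (rule int.genideal_ideal) simp
  have "ZMod k = (+>\<^bsub>\<Z>\<^esub>) (Idl\<^bsub>\<Z>\<^esub> {k})"
    by (rule ext) (simp add: ZMod_def)
  thus ?thesis
    unfolding ZFact_def using rcos_ring_hom_cring[OF int_is_cring] by simp
qed

lemma carrier_ZFact: "carrier (ZFact k) = range (ZMod k)"
  by (auto simp: ZFact_defs A_RCOSETS_defs ZMod_def a_r_coset_defs)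

lemma ZMod_eq_cong: "ZMod k a = ZMod k b \<longleftrightarrow> [a = b] (mod k)"
  by (simp add: ZMod_eq_mod cong_def)

lemma finite_carrier_Zmod:
  assumes "n \<ge> 1"
  shows "finite (carrier (Zmod n))"
proof -
  have "ZMod (int n) a \<in> ZMod (int n) ` {0..<int n}" for a
    using assms by (intro image_eqI[of _ _ "a mod int n"]) (auto simp: ZMod_eq_mod)
  hence "carrier (Zmod n) \<subseteq> ZMod (int n) ` {0..<int n}"
    by (auto simp: carrier_ZFact)
  thus ?thesis by (rule finite_subset) simp
qed

lemma ZMod_mult: "ZMod k (a * b) = ZMod k a \<otimes>\<^bsub>ZFact k\<^esub> ZMod k b"
  and ZMod_one: "ZMod k 1 = \<one>\<^bsub>ZFact k\<^esub>"
  and ZMod_minus: "ZMod k (- a) = \<ominus>\<^bsub>ZFact k\<^esub> ZMod k a"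
  and ZMod_diff: "ZMod k (a - b) = ZMod k a \<ominus>\<^bsub>ZFact k\<^esub> ZMod k b"
  and ZMod_square: "ZMod k (a\<^sup>2) = ZMod k a [^]\<^bsub>ZFact k\<^esub> (2::nat)"
proof -
  interpret ring_hom_cring \<Z> "ZFact k" "ZMod k" by (rule ZMod_ring_hom)
  show mult: "ZMod k (a * b) = ZMod k a \<otimes>\<^bsub>ZFact k\<^esub> ZMod k b" for a b
    using hom_mult[of a b] by simp
  show "ZMod k 1 = \<one>\<^bsub>ZFact k\<^esub>"
    using hom_one by simp
  show minus: "ZMod k (- a) = \<ominus>\<^bsub>ZFact k\<^esub> ZMod k a" for a
    using hom_a_inv[of a] by simp
  show "ZMod k (a - b) = ZMod k a \<ominus>\<^bsub>ZFact k\<^esub> ZMod k b"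
    using hom_add[of a "- b"] minus[of b] by (simp add: a_minus_def)
  show "ZMod k (a\<^sup>2) = ZMod k a [^]\<^bsub>ZFact k\<^esub> (2::nat)"
    using hom_closed[of a] by (simp add: power2_eq_square mult numeral_2_eq_2)
qed

lemma ZMod_Units_iff: "ZMod k u \<in> Units (ZFact k) \<longleftrightarrow> coprime u k"
proof -
  have "ZMod k u \<in> Units (ZFact k) \<longleftrightarrow> (\<exists>v. [u * v = 1] (mod k))"
    unfolding Units_def carrier_ZFact ZMod_eq_cong[symmetric] ZMod_one
    by (auto simp: ZMod_mult[symmetric] mult.commute)
  also have "\<dots> \<longleftrightarrow> coprime u k"
    by (simp add: coprime_iff_invertible_int)
  finally show ?thesis .
qed

lemma ZMod_in_pm_unit_squares_iff:
  "ZMod (int n) t \<in> pm_unit_squares n \<longleftrightarrow> usq n t \<or> usq n (- t)"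
proof -
  have sq: "ZMod (int n) s \<in> unit_squares n \<longleftrightarrow> usq n s" for s
  proof -
    have "ZMod (int n) s \<in> unit_squares n \<longleftrightarrow>
        (\<exists>u. ZMod (int n) u \<in> Units (Zmod n) \<and> ZMod (int n) s = ZMod (int n) u [^]\<^bsub>Zmod n\<^esub> (2::nat))"
      unfolding unit_squares_def using carrier_ZFact[of "int n"] by (auto simp: Units_def)
    thus ?thesis
      by (auto simp: ZMod_square[symmetric] ZMod_Units_iff ZMod_eq_cong usq_def cong_sym_eq)
  qed
  have "unit_squares n \<subseteq> range (ZMod (int n))"
    unfolding unit_squares_def using carrier_ZFact[of "int n"]
    by (auto simp: Units_def ZMod_square[symmetric])
  hence "(\<exists>q. ZMod (int n) t = \<ominus>\<^bsub>Zmod n\<^esub> q \<and> q \<in> unit_squares n) \<longleftrightarrow>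
      (\<exists>s. ZMod (int n) t = ZMod (int n) (- s) \<and> usq n s)"
    unfolding ZMod_minus using sq by blast
  also have "\<dots> \<longleftrightarrow> usq n (- t)"
  proof
    assume "\<exists>s. ZMod (int n) t = ZMod (int n) (- s) \<and> usq n s"
    then obtain s where s: "[- t = s] (mod int n)" "usq n s"
      unfolding ZMod_eq_cong using cong_minus_minus_iff by fastforce
    thus "usq n (- t)" using usq_cong[OF s(1)] by simp
  next
    assume "usq n (- t)"
    thus "\<exists>s. ZMod (int n) t = ZMod (int n) (- s) \<and> usq n s"
      by (intro exI[of _ "- t"]) simp
  qed
  finally show ?thesis
    by (auto simp: pm_unit_squares_def sq)
qed

text \<open>The bridge from the quotient ring to congruences: it lets adjacency be checked on
  arbitrary integer representatives through \<open>quc_adj\<close>.\<close>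

lemma quc_edges_iff: "{ZMod (int n) a, ZMod (int n) b} \<in> quc_edges n \<longleftrightarrow> quc_adj n a b"
proof
  assume "quc_adj n a b"
  thus "{ZMod (int n) a, ZMod (int n) b} \<in> quc_edges n"
    unfolding quc_edges_def quc_adj_def ZMod_eq_cong[symmetric]
    using ZMod_in_pm_unit_squares_iff[of n "a - b"]
    by (intro CollectI exI[of _ "ZMod (int n) a"] exI[of _ "ZMod (int n) b"])
      (auto simp: carrier_ZFact ZMod_diff)
next
  have adj: "quc_adj n a b"
    if "ZMod (int n) a \<noteq> ZMod (int n) b"
      "ZMod (int n) a \<ominus>\<^bsub>Zmod n\<^esub> ZMod (int n) b \<in> pm_unit_squares n" for a b
    using that ZMod_in_pm_unit_squares_iff[of n "a - b"]
    unfolding quc_adj_def ZMod_eq_cong[symmetric] by (simp add: ZMod_diff)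
  assume "{ZMod (int n) a, ZMod (int n) b} \<in> quc_edges n"
  then obtain x y where xy: "{ZMod (int n) a, ZMod (int n) b} = {x, y}" "x \<noteq> y"
      "x \<ominus>\<^bsub>Zmod n\<^esub> y \<in> pm_unit_squares n"
    unfolding quc_edges_def by blast
  from xy(1) consider "x = ZMod (int n) a" "y = ZMod (int n) b" |
      "x = ZMod (int n) b" "y = ZMod (int n) a"
    unfolding doubleton_eq_iff by blast
  thus "quc_adj n a b"
  proof cases
    case 1 thus ?thesis using xy adj by simp
  next
    case 2
    hence "quc_adj n b a" using xy adj by simp
    thus ?thesis by (auto simp: quc_adj_def cong_sym_eq)
  qed
qed

lemma quc_edges_no_loop:
  assumes "v \<in> carrier (Zmod n)"
  shows "{v} \<notin> quc_edges n"
proof -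
  obtain a where "v = ZMod (int n) a" using assms by (auto simp: carrier_ZFact)
  thus ?thesis using quc_edges_iff[of n a a] by (simp add: quc_adj_def)
qed

section \<open>Unit squares modulo products and prime powers\<close>

lemma usq_mult: "usq n s \<Longrightarrow> usq n t \<Longrightarrow> usq n (s * t)"
  unfolding usq_def
proof (elim exE conjE)
  fix u v assume "coprime u n" "[u\<^sup>2 = s] (mod n)" "coprime v n" "[v\<^sup>2 = t] (mod n)"
  thus "\<exists>w. coprime w n \<and> [w\<^sup>2 = s * t] (mod n)"
    by (intro exI[of _ "u * v"]) (auto simp: power_mult_distrib intro: cong_mult)
qed

lemma usq_square: "coprime u n \<Longrightarrow> usq n (u\<^sup>2)"
  unfolding usq_def by (intro exI[of _ u]) simp

lemma usq_one: "usq n 1"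
  using usq_square[of 1 n] by simp

lemma usq_coprime:
  assumes "usq n t"
  shows "coprime t n"
proof -
  obtain u where "coprime u n" "[u\<^sup>2 = t] (mod n)" using assms unfolding usq_def by blast
  thus ?thesis by (metis cong_imp_coprime coprime_power_left_iff zero_less_numeral)
qed

lemma usq_dvd: "usq n t \<Longrightarrow> d dvd n \<Longrightarrow> usq d t"
  unfolding usq_def by (blast intro: cong_dvd_modulus coprime_divisors dvd_refl)

text \<open>Square roots modulo \<open>m\<close> and \<open>n\<close> are glued by the Chinese
  remainder theorem.\<close>

lemma usq_coprime_modulus_iff:
  assumes "coprime m n"
  shows "usq (m * n) t \<longleftrightarrow> usq m t \<and> usq n t"
proof
  assume "usq (m * n) t"
  thus "usq m t \<and> usq n t" using usq_dvd by (meson dvd_triv_left dvd_triv_right)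
next
  assume "usq m t \<and> usq n t"
  then obtain u v where uv: "coprime u m" "[u\<^sup>2 = t] (mod m)" "coprime v n" "[v\<^sup>2 = t] (mod n)"
    unfolding usq_def by blast
  obtain w where w: "[w = u] (mod m)" "[w = v] (mod n)"
    using binary_chinese_remainder_int[OF assms] by blast
  have "coprime w (m * n)"
    using uv w by (metis cong_imp_coprime cong_sym coprime_mult_right_iff)
  moreover have "[w\<^sup>2 = t] (mod m * n)"
    using uv w assms by (meson coprime_cong_mult cong_pow cong_trans)
  ultimately show "usq (m * n) t" unfolding usq_def by blast
qed

text \<open>Hensel lifting: the root \<open>u\<close> modulo \<open>p ^ m\<close> is corrected by a multiple of \<open>p ^ m\<close>.\<close>

lemma usq_prime_power:
  assumes "prime p" "odd p" "usq (int p) t"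
  shows "usq (int (p ^ m)) t"
proof (cases m)
  case 0
  thus ?thesis unfolding usq_def by (intro exI[of _ 1]) simp
next
  case (Suc k)
  have "usq (int (p ^ Suc k)) t"
  proof (induction k)
    case 0
    thus ?case using assms by simp
  next
    case (Suc k)
    let ?q = "int (p ^ Suc k)"
    obtain u where u: "coprime u ?q" "[u\<^sup>2 = t] (mod ?q)"
      using Suc unfolding usq_def by blast
    have cop: "coprime u (int p)" using u(1) by simp
    from u(2) obtain c where c: "t = u\<^sup>2 + ?q * c"
      by (metis cong_iff_lin)
    have "coprime (2 * u) (int p)"
      using cop assms(2) by (simp add: coprime_left_2_iff_odd)
    then obtain z where z: "[2 * u * z = 1] (mod int p)"
      using cong_solve_coprime_int by blast
    have "[2 * u * (z * c) = c] (mod int p)"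
      using cong_mult[OF z cong_refl[of c]] by (simp add: mult.assoc)
    then obtain d where d: "c = 2 * u * (z * c) + int p * d"
      by (metis cong_iff_lin)
    \<comment> \<open>Since \<open>z\<close> inverts \<open>2 * u\<close> modulo \<open>p\<close>,
      the linear term of the square of \<open>?w\<close> cancels \<open>?q * c\<close> modulo
      \<open>p * ?q\<close>; the quadratic term vanishes there because \<open>p\<close> divides
      \<open>?q\<close>.\<close>
    let ?w = "u + ?q * (z * c)"
    have "int p dvd ?q" by simp
    then obtain e where e: "?q = int p * e" ..
    have "t - ?w\<^sup>2 = ?q * (c - 2 * u * (z * c)) - ?q * ?q * (z * c)\<^sup>2"
      using c by (simp add: power2_eq_square algebra_simps)
    also have "c - 2 * u * (z * c) = int p * d"
      using d by linarith
    also have "?q * (int p * d) - ?q * ?q * (z * c)\<^sup>2 = ?q * (int p * d) - ?q * (int p * e) * (z * c)\<^sup>2"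
      using e by simp
    also have "\<dots> = (int p * ?q) * (d - e * (z * c)\<^sup>2)"
      by (simp only: algebra_simps)
    finally have "[?w\<^sup>2 = t] (mod int p * ?q)"
      by (metis cong_iff_dvd_diff cong_sym dvd_triv_left)
    moreover have "coprime ?w (int p)"
      using cop e by (metis cong_add_lcancel_0 cong_imp_coprime cong_mult_self_left cong_sym mult.assoc)
    ultimately show ?case
      unfolding usq_def by (intro exI[of _ ?w]) simp
  qed
  thus ?thesis using Suc by simp
qed

section \<open>Quadratic residues modulo an odd prime\<close>

context
  fixes p :: nat
  assumes p: "prime p" "odd p"
begin

lemma odd_prime_gt_2: "p > 2"
  using p prime_gt_1_nat[of p] by (cases "p = 2") auto

lemma usq_iff_Legendre: "usq (int p) t \<longleftrightarrow> Legendre t (int p) = 1"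
proof -
  have prime: "prime (int p)" using p by simp
  have "(\<exists>u. coprime u (int p) \<and> [u\<^sup>2 = t] (mod int p)) \<longleftrightarrow>
      \<not> [t = 0] (mod int p) \<and> (\<exists>u. [u\<^sup>2 = t] (mod int p))"
  proof -
    have "coprime u (int p) \<longleftrightarrow> \<not> [t = 0] (mod int p)" if "[u\<^sup>2 = t] (mod int p)" for u
    proof -
      have "coprime u (int p) \<longleftrightarrow> \<not> int p dvd u"
        using prime by (metis coprime_absorb_left coprime_commute not_prime_unit prime_imp_coprime)
      also have "\<dots> \<longleftrightarrow> \<not> int p dvd u\<^sup>2"
        using prime by (simp add: prime_dvd_power_iff)
      also have "\<dots> \<longleftrightarrow> \<not> [t = 0] (mod int p)"
        using that by (metis cong_0_iff cong_dvd_iff)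
      finally show ?thesis .
    qed
    thus ?thesis by blast
  qed
  thus ?thesis unfolding usq_def Legendre_def QuadRes_def by simp
qed

lemma Legendre_cases: "Legendre t (int p) \<in> {-1, 0, 1}"
  by (simp add: Legendre_def)

lemma Legendre_eq_0_iff: "Legendre t (int p) = 0 \<longleftrightarrow> int p dvd t"
  by (simp add: Legendre_def cong_0_iff)

text \<open>Two elements of \<open>{-1, 0, 1}\<close> differ by at most \<open>2 < p\<close>, so
  congruence modulo \<open>p\<close> forces equality.\<close>

lemma Legendre_eqI:
  assumes "[Legendre t (int p) = e] (mod int p)" "e \<in> {-1, 0, 1}"
  shows "Legendre t (int p) = e"
proof -
  have "int p dvd Legendre t (int p) - e"
    using assms(1) by (simp add: cong_iff_dvd_diff)
  moreover have "\<bar>Legendre t (int p) - e\<bar> < int p"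
    using Legendre_cases[of t] assms(2) odd_prime_gt_2 by auto
  ultimately show ?thesis
    using zdvd_imp_le[of "int p" "\<bar>Legendre t (int p) - e\<bar>"] by fastforce
qed

text \<open>Euler's criterion replaces the symbol by a power, which is multiplicative.\<close>

lemma Legendre_mult: "Legendre (a * b) (int p) = Legendre a (int p) * Legendre b (int p)"
proof (rule Legendre_eqI)
  note E = euler_criterion[OF p(1) odd_prime_gt_2]
  show "[Legendre (a * b) (int p) = Legendre a (int p) * Legendre b (int p)] (mod int p)"
    using cong_trans[OF E[of "a * b"] cong_sym[OF cong_mult[OF E[of a] E[of b], folded power_mult_distrib]]] .
  show "Legendre a (int p) * Legendre b (int p) \<in> {- 1, 0, 1}"
    using Legendre_cases[of a] Legendre_cases[of b] by auto
qed

lemma Legendre_minus_one: "Legendre (-1) (int p) = (-1) ^ ((p - 1) div 2)"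
  by (rule Legendre_eqI[OF euler_criterion[OF p(1) odd_prime_gt_2]])
    (cases "even ((p - 1) div 2)"; simp)

lemma usq_minus_one_iff: "usq (int p) (-1) \<longleftrightarrow> p mod 4 = 1"
proof -
  have "even ((p - 1) div 2) \<longleftrightarrow> p mod 4 = 1"
    using p(2) by presburger
  thus ?thesis
    unfolding usq_iff_Legendre Legendre_minus_one by (cases "even ((p - 1) div 2)") auto
qed

lemma usq_mult_left_iff: "usq (int p) a \<Longrightarrow> usq (int p) (a * b) \<longleftrightarrow> usq (int p) b"
  by (simp add: usq_iff_Legendre Legendre_mult)

text \<open>Multiplication by a nonresidue flips the sign of the Legendre symbol, so it exchanges
  residues and nonresidues.\<close>

lemma usq_nonresidue_mult_left:
  assumes "\<not> int p dvd a" "\<not> usq (int p) a"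
  shows "usq (int p) (a * b) \<longleftrightarrow> \<not> int p dvd b \<and> \<not> usq (int p) b"
  using assms Legendre_cases[of a] Legendre_cases[of b]
  by (auto simp: usq_iff_Legendre Legendre_mult Legendre_eq_0_iff[symmetric])

lemma usq_not_dvd: "usq (int p) a \<Longrightarrow> \<not> int p dvd a"
  by (auto simp: usq_iff_Legendre Legendre_eq_0_iff[symmetric])

text \<open>Minimality is the point: \<open>l - 1\<close> and all smaller positive integers are
  residues, which provides residues at prescribed distances.\<close>

lemma least_nonresidue:
  obtains l where "2 \<le> l" "l < int p" "\<not> int p dvd l" "\<not> usq (int p) l"
    "\<And>k. 0 < k \<Longrightarrow> k < l \<Longrightarrow> usq (int p) k"
proof -
  let ?S = "{1..<int p}"
  have ndvd: "\<not> int p dvd x" if "x \<in> ?S" for x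
    using that zdvd_not_zless by auto
  have "\<exists>l\<in>?S. \<not> usq (int p) l"
  proof (rule ccontr)
    assume all: "\<not> (\<exists>l\<in>?S. \<not> usq (int p) l)"
    let ?f = "\<lambda>u. u\<^sup>2 mod int p"
    have "?S \<subseteq> ?f ` ?S"
    proof
      fix t assume t: "t \<in> ?S"
      then obtain u where u: "coprime u (int p)" "[u\<^sup>2 = t] (mod int p)"
        using all unfolding usq_def by blast
      have "t = ?f (u mod int p)"
        using u(2) t by (simp add: cong_def power_mod)
      moreover have "u mod int p \<noteq> 0"
      proof
        assume "u mod int p = 0"
        hence "coprime 0 (int p)" using u(1) by (metis coprime_mod_left_iff odd_prime_gt_2 gr_implies_not0 of_nat_0_eq_iff)
        thus False using odd_prime_gt_2 by simp
      qed
      hence "u mod int p \<in> ?S"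
        using odd_prime_gt_2 pos_mod_sign[of "int p" u] by auto
      ultimately show "t \<in> ?f ` ?S" by blast
    qed
    \<comment> \<open>If every nonzero class were a square, squaring would map the finite set
      \<open>?S\<close> onto itself and hence be injective, but \<open>1\<close> and
      \<open>p - 1\<close> have the same square.\<close>
    hence "inj_on ?f ?S"
      by (intro finite_surj_inj) auto
    moreover have "?f (int p - 1) = ?f 1"
    proof -
      have "[int p - 1 = - 1] (mod int p)" by (simp add: cong_def)
      from cong_pow[OF this, of 2] show ?thesis by (simp add: cong_def)
    qed
    moreover have "int p - 1 \<in> ?S" "1 \<in> ?S" using odd_prime_gt_2 by auto
    ultimately have "int p - 1 = 1" by (rule inj_onD)
    thus False using odd_prime_gt_2 by simp
  qed
  then obtain l0 where l0: "l0 \<in> ?S" "\<not> usq (int p) l0" by blast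
  let ?P = "\<lambda>k::nat. k > 0 \<and> \<not> usq (int p) (int k)"
  have P0: "?P (nat l0)" using l0 by auto
  define l where "l = (LEAST k. ?P k)"
  have l: "?P l" unfolding l_def using P0 by (rule LeastI)
  have min: "usq (int p) (int k)" if "0 < k" "k < l" for k
    using not_less_Least[of k ?P] that unfolding l_def by blast
  have "l \<le> nat l0" unfolding l_def using P0 by (rule Least_le)
  hence "int l < int p" using l0 by auto
  moreover have "l \<noteq> 1" using l usq_one[of "int p"] by (metis of_nat_1)
  hence "2 \<le> int l" using l by linarith
  moreover have "usq (int p) k" if "0 < k" "k < int l" for k
    using min[of "nat k"] that by simp
  ultimately show ?thesis using that[of "int l"] l ndvd[of "int l"] by auto
qed

end

section \<open>Adjacency tests and the perfect cases\<close>

lemma quc_adj_sym: "quc_adj n a b \<longleftrightarrow> quc_adj n b a"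
  by (auto simp: quc_adj_def cong_sym_eq)

text \<open>For \<open>n > 1\<close> zero is not a unit, so a difference that is a unit square
  already separates \<open>a\<close> from \<open>b\<close>.\<close>

lemma quc_adjI:
  assumes "n > 1" "usq n (a - b) \<or> usq n (b - a)"
  shows "quc_adj n a b"
proof -
  have "\<not> [a = b] (mod int n)"
  proof
    assume "[a = b] (mod int n)"
    hence "[a - b = 0] (mod int n)" "[b - a = 0] (mod int n)"
      using cong_diff_iff_cong_0 cong_sym by blast+
    hence "usq n 0" using assms(2) usq_cong by blast
    thus False using usq_coprime[of n 0] assms(1) by simp
  qed
  thus ?thesis using assms(2) by (simp add: quc_adj_def)
qed

text \<open>A unit square modulo \<open>n\<close> stays one modulo every divisor, so non-adjacency
  can be detected modulo a single divisor.\<close>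

lemma not_quc_adjI:
  assumes "d dvd n" "\<not> usq (int d) (a - b)" "\<not> usq (int d) (b - a)"
  shows "\<not> quc_adj n a b"
  using assms usq_dvd[of "int n" _ "int d"] by (auto simp: quc_adj_def)

lemma not_quc_adj_cong:
  assumes "d dvd n" "[a = b] (mod int d)" "d > 1"
  shows "\<not> quc_adj n a b"
proof (rule not_quc_adjI[OF assms(1)])
  have "[a - b = 0] (mod int d)" "[b - a = 0] (mod int d)"
    using assms(2) cong_diff_iff_cong_0 cong_sym by blast+
  moreover have "\<not> usq (int d) 0" using usq_coprime[of "int d" 0] assms(3) by auto
  ultimately show "\<not> usq (int d) (a - b)" "\<not> usq (int d) (b - a)"
    using usq_cong by blast+
qed

lemma carrier_Zmod_rep:
  assumes "v \<in> carrier (Zmod n)"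
  shows "ZMod (int n) (SOME a. v = ZMod (int n) a) = v"
  using assms someI_ex[of "\<lambda>a. v = ZMod (int n) a"] by (auto simp: carrier_ZFact)

lemma quc_edges_rep_iff:
  assumes "v \<in> carrier (Zmod n)" "w \<in> carrier (Zmod n)"
  shows "{v, w} \<in> quc_edges n \<longleftrightarrow>
    quc_adj n (SOME a. v = ZMod (int n) a) (SOME a. w = ZMod (int n) a)"
  unfolding quc_edges_iff[symmetric] carrier_Zmod_rep[OF assms(1)] carrier_Zmod_rep[OF assms(2)] ..

text \<open>Units modulo an even number are odd, so adjacent vertices have representatives of
  opposite parity.\<close>

lemma perfect_even:
  assumes "n \<ge> 1" "even n"
  shows "perfect_graph (carrier (Zmod n)) (quc_edges n)"
proof (rule bipartite_perfect[OF finite_carrier_Zmod[OF assms(1)]])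
  fix v w
  let ?r = "\<lambda>v. SOME a. v = ZMod (int n) a"
  assume "v \<in> carrier (Zmod n)" "w \<in> carrier (Zmod n)" "{v, w} \<in> quc_edges n"
  hence "quc_adj n (?r v) (?r w)"
    using quc_edges_rep_iff by blast
  hence "\<not> [?r v = ?r w] (mod int 2)"
    using not_quc_adj_cong[of 2 n] assms(2) by auto
  thus "even (?r v) \<noteq> even (?r w)"
    by (auto simp: cong_def even_iff_mod_2_eq_zero odd_iff_mod_2_eq_one)
qed

text \<open>As \<open>-1\<close> is a nonresidue modulo \<open>p\<close>, one of
  \<open>a - b\<close> and \<open>b - a\<close> is a residue whenever \<open>p\<close> does not
  divide them; Hensel lifting passes to \<open>p ^ m\<close>.\<close>

lemma quc_adj_3_mod_4_prime_power_iff: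
  assumes "prime p" "p mod 4 = 3" "m > 0"
  shows "quc_adj (p ^ m) a b \<longleftrightarrow> \<not> [a = b] (mod int p)"
proof
  have dvd: "p dvd p ^ m" using assms(3) by simp
  show "\<not> [a = b] (mod int p)" if "quc_adj (p ^ m) a b"
    using that not_quc_adj_cong[OF dvd] prime_gt_1_nat[OF assms(1)] by blast
  assume ne: "\<not> [a = b] (mod int p)"
  have odd: "odd p" using assms(2) by presburger
  have nd: "\<not> int p dvd (a - b)" using ne by (simp add: cong_iff_dvd_diff)
  have "\<not> usq (int p) (-1)"
    using usq_minus_one_iff[OF assms(1) odd] assms(2) by simp
  moreover have "\<not> int p dvd -1"
    using prime_gt_1_nat[OF assms(1)] by auto
  ultimately have "usq (int p) (a - b) \<or> usq (int p) (b - a)"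
    using usq_nonresidue_mult_left[OF assms(1) odd, of "-1" "a - b"] nd by auto
  thus "quc_adj (p ^ m) a b"
    using usq_prime_power[OF assms(1) odd] one_less_power[OF prime_gt_1_nat[OF assms(1)] assms(3)]
    by (intro quc_adjI) blast+
qed

lemma perfect_3_mod_4_prime_power:
  assumes "prime p" "p mod 4 = 3"
  shows "perfect_graph (carrier (Zmod (p ^ m))) (quc_edges (p ^ m))"
proof (rule complete_multipartite_perfect)
  let ?n = "p ^ m"
  have pos: "p > 0" using assms(1) by (rule prime_gt_0_nat)
  thus "finite (carrier (Zmod ?n))"
    by (intro finite_carrier_Zmod) (simp add: Suc_leI)
  let ?r = "\<lambda>v. SOME a. v = ZMod (int ?n) a"
  fix v w
  assume "v \<in> carrier (Zmod ?n)" "w \<in> carrier (Zmod ?n)"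
  hence "{v, w} \<in> quc_edges ?n \<longleftrightarrow> quc_adj ?n (?r v) (?r w)"
    by (rule quc_edges_rep_iff)
  \<comment> \<open>For \<open>m = 0\<close> there is a single vertex, and the modulus
    \<open>1\<close> puts everything into one class.\<close>
  also have "\<dots> \<longleftrightarrow> ?r v mod int (if m = 0 then 1 else p) \<noteq> ?r w mod int (if m = 0 then 1 else p)"
  proof (cases "m = 0")
    case True
    thus ?thesis by (simp add: quc_adj_def)
  next
    case False
    thus ?thesis using quc_adj_3_mod_4_prime_power_iff[OF assms, of m] by (simp add: cong_def)
  qed
  finally show "{v, w} \<in> quc_edges ?n \<longleftrightarrow>
    ?r v mod int (if m = 0 then 1 else p) \<noteq> ?r w mod int (if m = 0 then 1 else p)" .
qed

section \<open>Odd closed walks, and moduli divisible by 5\<close>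

lemma quc_near_bipartite:
  assumes "perfect_graph (carrier (Zmod n)) (quc_edges n)"
    and fin: "finite A" "finite B"
    and A: "\<And>x y. x \<in> A \<Longrightarrow> y \<in> A \<Longrightarrow> \<not> quc_adj n x y"
    and B: "\<And>x y. x \<in> B \<Longrightarrow> y \<in> B \<Longrightarrow> \<not> quc_adj n x y"
    and r: "\<And>x. x \<in> A \<Longrightarrow> quc_adj n r x \<Longrightarrow> x = a" "\<And>x. x \<in> B \<Longrightarrow> quc_adj n r x \<Longrightarrow> x = b"
    and ab: "\<not> quc_adj n a b"
  obtains f :: "int \<Rightarrow> bool" where
    "\<And>x y. x \<in> insert r (A \<union> B) \<Longrightarrow> y \<in> insert r (A \<union> B) \<Longrightarrow> quc_adj n x y \<Longrightarrow> f x \<noteq> f y"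
proof -
  let ?Z = "ZMod (int n)"
  obtain f :: "int set \<Rightarrow> bool" where f:
    "\<And>v w. v \<in> insert (?Z r) (?Z ` A \<union> ?Z ` B) \<Longrightarrow> w \<in> insert (?Z r) (?Z ` A \<union> ?Z ` B) \<Longrightarrow>
      {v, w} \<in> quc_edges n \<Longrightarrow> f v \<noteq> f w"
  proof (rule perfect_graph_near_bipartite[OF assms(1) quc_edges_no_loop,
        of "?Z ` A" "?Z ` B" "?Z r" "?Z a" "?Z b"])
    show "insert (?Z r) (?Z ` A \<union> ?Z ` B) \<subseteq> carrier (Zmod n)"
      by (auto simp: carrier_ZFact)
    show "indep (?Z ` A) (quc_edges n)" "indep (?Z ` B) (quc_edges n)"
      using A B by (auto simp: indep_def quc_edges_iff)
    show "x = ?Z a" if "x \<in> ?Z ` A" "{?Z r, x} \<in> quc_edges n" for x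
      using that r(1) by (auto simp: quc_edges_iff)
    show "x = ?Z b" if "x \<in> ?Z ` B" "{?Z r, x} \<in> quc_edges n" for x
      using that r(2) by (auto simp: quc_edges_iff)
  qed (use fin ab in \<open>auto simp: quc_edges_iff\<close>)
  show ?thesis
  proof (rule that[of "f \<circ> ?Z"])
    fix x y assume "x \<in> insert r (A \<union> B)" "y \<in> insert r (A \<union> B)" "quc_adj n x y"
    thus "(f \<circ> ?Z) x \<noteq> (f \<circ> ?Z) y"
      using f[of "?Z x" "?Z y"] by (auto simp: quc_edges_iff)
  qed
qed

text \<open>The odd-indexed vertices and the even-indexed ones other than \<open>v0\<close> form two
  independent sets, and \<open>v0\<close> has only the non-adjacent neighbours \<open>v1\<close> and
  \<open>v6\<close> among them. Perfection would then give a 2-colouring, contradicting the closed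
  walk of odd length.\<close>

lemma not_perfect_walk7:
  assumes "n > 1"
    and "quc_adj n v0 v1" "quc_adj n v1 v2" "quc_adj n v2 v3" "quc_adj n v3 v4"
      "quc_adj n v4 v5" "quc_adj n v5 v6" "quc_adj n v6 v0"
    and "\<not> quc_adj n v1 v3" "\<not> quc_adj n v1 v5" "\<not> quc_adj n v3 v5"
    and "\<not> quc_adj n v2 v4" "\<not> quc_adj n v2 v6" "\<not> quc_adj n v4 v6"
    and "\<not> quc_adj n v0 v2" "\<not> quc_adj n v0 v3" "\<not> quc_adj n v0 v4" "\<not> quc_adj n v0 v5"
    and "\<not> quc_adj n v1 v6"
  shows "\<not> perfect_graph (carrier (Zmod n)) (quc_edges n)"
proof
  assume perf: "perfect_graph (carrier (Zmod n)) (quc_edges n)"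
  have irrefl: "\<not> quc_adj n x x" for x by (simp add: quc_adj_def)
  obtain f :: "int \<Rightarrow> bool" where f: "\<And>x y. x \<in> insert v0 ({v1, v3, v5} \<union> {v2, v4, v6}) \<Longrightarrow>
      y \<in> insert v0 ({v1, v3, v5} \<union> {v2, v4, v6}) \<Longrightarrow> quc_adj n x y \<Longrightarrow> f x \<noteq> f y"
  proof (rule quc_near_bipartite[OF perf, of "{v1, v3, v5}" "{v2, v4, v6}" v0 v1 v6])
    show "\<not> quc_adj n x y" if "x \<in> {v1, v3, v5}" "y \<in> {v1, v3, v5}" for x y
      using that assms(9-11) irrefl quc_adj_sym by blast
    show "\<not> quc_adj n x y" if "x \<in> {v2, v4, v6}" "y \<in> {v2, v4, v6}" for x y
      using that assms(12-14) irrefl quc_adj_sym by blast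
  qed (use assms in auto)
  have "f v0 \<noteq> f v1" "f v1 \<noteq> f v2" "f v2 \<noteq> f v3" "f v3 \<noteq> f v4" "f v4 \<noteq> f v5" "f v5 \<noteq> f v6" "f v6 \<noteq> f v0"
    using f[of v0 v1] f[of v1 v2] f[of v2 v3] f[of v3 v4] f[of v4 v5] f[of v5 v6] f[of v6 v0] assms(2-8)
    by simp_all
  thus False by auto
qed

lemma not_usq_2_3_mod_5: "[t = 2] (mod 5) \<or> [t = 3] (mod 5) \<Longrightarrow> \<not> usq 5 t"
proof
  assume t: "[t = 2] (mod 5) \<or> [t = 3] (mod 5)" and "usq 5 t"
  then obtain u where "u\<^sup>2 mod 5 = t mod 5" by (auto simp: usq_def cong_def)
  moreover have "u\<^sup>2 mod 5 = (u mod 5)\<^sup>2 mod 5" by (simp add: power_mod)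
  moreover have "u mod 5 \<in> {0, 1, 2, 3, 4}" by auto
  ultimately show False using t by (auto simp: cong_def)
qed

text \<open>Neighbours on the 5-cycle differ by \<open>1\<close> or by \<open>4\<close>, the square
  of the unit \<open>2\<close>; the chords differ by \<open>2\<close> or \<open>3\<close> up to
  sign, which are nonsquares modulo \<open>5\<close>.\<close>

lemma not_perfect_5_dvd:
  assumes "odd n" "5 dvd n"
  shows "\<not> perfect_graph (carrier (Zmod n)) (quc_edges n)"
proof
  assume perf: "perfect_graph (carrier (Zmod n)) (quc_edges n)"
  have n: "n > 1" using assms by (cases "n = 0 \<or> n = 1") auto
  have adj: "quc_adj n x y" if "y = x + 1" for x y
    using quc_adjI[OF n, of y x] usq_one[of "int n"] that quc_adj_sym by simp
  have "coprime 2 (int n)" using assms(1) by simp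
  hence adj4: "quc_adj n 0 4"
    using quc_adjI[OF n, of 0 4] usq_square[of 2 "int n"] by simp
  have nadj: "\<not> quc_adj n x y" if "x - y \<in> {2, -2, 3, -3}" for x y
  proof (rule not_quc_adjI[OF assms(2)])
    have "x = y + 2 \<or> x = y - 2 \<or> x = y + 3 \<or> x = y - 3" using that by auto
    thus "\<not> usq (int 5) (x - y)" "\<not> usq (int 5) (y - x)"
      using not_usq_2_3_mod_5[of 2] not_usq_2_3_mod_5[of 3] not_usq_2_3_mod_5[of "-2"]
        not_usq_2_3_mod_5[of "-3"] by (auto simp: cong_def)
  qed
  have irrefl: "\<not> quc_adj n x x" for x by (simp add: quc_adj_def)
  obtain f :: "int \<Rightarrow> bool" where f: "\<And>x y. x \<in> insert 0 ({1, 3} \<union> {2, 4}) \<Longrightarrow>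
      y \<in> insert 0 ({1, 3} \<union> {2, 4}) \<Longrightarrow> quc_adj n x y \<Longrightarrow> f x \<noteq> f y"
    by (rule quc_near_bipartite[OF perf, of "{1, 3}" "{2, 4}" 0 1 4])
      (use irrefl nadj in auto)
  have "f 0 \<noteq> f 1" "f 1 \<noteq> f 2" "f 2 \<noteq> f 3" "f 3 \<noteq> f 4" "f 0 \<noteq> f 4"
    using f[of 0 1] f[of 1 2] f[of 2 3] f[of 3 4] f[of 0 4] adj adj4 by simp_all
  thus False by auto
qed

section \<open>Two coprime factors, each with a prime 3 modulo 4\<close>

text \<open>\<open>F\<close> is the Chinese remainder map. The sign in the connection set is common
  to both coordinates, so the two differences must be squares in the same orientation.\<close>

lemma quc_adj_crt:
  assumes "coprime P R" "P * R > 1"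
  obtains F where "\<And>x y x' y'. quc_adj (P * R) (F x y) (F x' y') \<longleftrightarrow>
    usq P (x - x') \<and> usq R (y - y') \<or> usq P (x' - x) \<and> usq R (y' - y)"
proof -
  have cop: "coprime (int P) (int R)" using assms(1) by simp
  have "\<forall>x y. \<exists>z. [z = x] (mod int P) \<and> [z = y] (mod int R)"
    using binary_chinese_remainder_int[OF cop] by blast
  then obtain F where F: "\<And>x y. [F x y = x] (mod int P)" "\<And>x y. [F x y = y] (mod int R)"
    by metis
  have usq: "usq (int (P * R)) (F x y - F x' y') \<longleftrightarrow> usq P (x - x') \<and> usq R (y - y')" for x y x' y'
    using usq_coprime_modulus_iff[OF cop] usq_cong[OF cong_diff[OF F(1) F(1)]]
      usq_cong[OF cong_diff[OF F(2) F(2)]] by simp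
  have "quc_adj (P * R) (F x y) (F x' y') \<longleftrightarrow>
    usq P (x - x') \<and> usq R (y - y') \<or> usq P (x' - x) \<and> usq R (y' - y)" for x y x' y'
    using quc_adjI[OF assms(2)] unfolding usq[symmetric] quc_adj_def by blast
  thus ?thesis by (rule that)
qed

lemma not_usq_0: "m > 1 \<Longrightarrow> \<not> usq (int m) 0"
  using usq_coprime[of "int m" 0] by auto

text \<open>Otherwise \<open>-1\<close> would be a residue modulo \<open>p\<close>. Thus each edge
  modulo \<open>m\<close> carries a unique orientation.\<close>

lemma not_usq_minus:
  assumes "prime p" "p mod 4 = 3" "p dvd m" "usq (int m) s"
  shows "\<not> usq (int m) (- s)"
proof
  assume "usq (int m) (- s)"
  hence "usq (int p) (- s)" "usq (int p) s"
    using assms(3,4) usq_dvd[of "int m" _ "int p"] by auto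
  moreover have "odd p" using assms(2) by presburger
  ultimately show False
    using usq_mult_left_iff[of p s "-1"] usq_minus_one_iff[of p] assms(1,2) by simp
qed

text \<open>Take \<open>l\<close> to be the least nonresidue: \<open>l - 1\<close> is a residue by
  minimality, and \<open>- l\<close> is a product of two nonresidues. With \<open>1\<close> these
  are the successive differences along the oriented triangle \<open>0, 1, l\<close>.\<close>

lemma consecutive_residues_3_mod_4:
  assumes "prime p" "p mod 4 = 3"
  obtains l where "usq (int (p ^ m)) (l - 1)" "usq (int (p ^ m)) (- l)"
proof -
  have odd: "odd p" using assms(2) by presburger
  obtain l where l: "2 \<le> l" "\<not> int p dvd l" "\<not> usq (int p) l" "\<And>k. 0 < k \<Longrightarrow> k < l \<Longrightarrow> usq (int p) k"
    using least_nonresidue[OF assms(1) odd] by metis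
  have "usq (int p) (-1 * l)"
  proof (subst usq_nonresidue_mult_left[OF assms(1) odd])
    show "\<not> int p dvd -1" using prime_gt_1_nat[OF assms(1)] by auto
    show "\<not> usq (int p) (-1)" using usq_minus_one_iff[OF assms(1) odd] assms(2) by simp
  qed (use l in blast)
  moreover have "usq (int p) (l - 1)" using l by auto
  ultimately show ?thesis
    using usq_prime_power[OF assms(1) odd] that[of l] by (simp del: of_nat_power)
qed

text \<open>
  Modulo \<open>P\<close> the vertices lie on the triangle \<open>0, 1, l\<close>, whose oriented edges are squares;
  modulo \<open>R\<close> consecutive vertices differ by one of the Pythagorean squares
  \<open>9\<^sup>2, 12\<^sup>2, 15\<^sup>2, 20\<^sup>2, 25\<^sup>2\<close>.
\<close>

lemma not_perfect_two_primes_3_mod_4: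
  assumes p: "prime p" "p mod 4 = 3" "a > 0" and q: "prime q" "q mod 4 = 3" "q dvd R"
    and R: "coprime p R" "odd R" "\<not> 3 dvd R" "\<not> 5 dvd R"
  shows "\<not> perfect_graph (carrier (Zmod (p ^ a * R))) (quc_edges (p ^ a * R))"
proof -
  let ?P = "p ^ a"
  have P1: "?P > 1" using p(3) by (intro one_less_power prime_gt_1_nat[OF p(1)])
  have "R > 0" using R(2) by (cases R) auto
  hence R1: "R > 1" using q dvd_imp_le[of q R] prime_gt_1_nat[of q] by linarith
  have n: "?P * R > 1" using P1 R1 by (metis less_1_mult)
  obtain F where F: "\<And>x y x' y'. quc_adj (?P * R) (F x y) (F x' y') \<longleftrightarrow>
    usq (int ?P) (x - x') \<and> usq R (y - y') \<or> usq (int ?P) (x' - x) \<and> usq R (y' - y)"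
    using quc_adj_crt[of ?P R] R(1) n by auto
  obtain l where l: "usq (int ?P) (l - 1)" "usq (int ?P) (- l)"
    using consecutive_residues_3_mod_4[OF p(1,2)] by blast
  have dvd: "p dvd ?P" using p(3) by simp
  have nl: "\<not> usq (int ?P) (1 - l)" "\<not> usq (int ?P) l" "\<not> usq (int ?P) (-1)"
    using not_usq_minus[OF p(1,2) dvd l(1)] not_usq_minus[OF p(1,2) dvd l(2)]
      not_usq_minus[OF p(1,2) dvd usq_one] by simp_all
  have "\<not> 3 dvd int R" "\<not> 5 dvd int R" using R(3,4) by presburger+
  hence "coprime (int R) 2" "coprime (int R) 3" "coprime (int R) 5"
    using R(2) prime_imp_coprime[of 3 "int R"] prime_imp_coprime[of 5 "int R"]
    by (auto simp: coprime_commute)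
  hence cop: "coprime 9 (int R)" "coprime 12 (int R)" "coprime 15 (int R)" "coprime 20 (int R)"
      "coprime 25 (int R)"
    using coprime_mult_left_iff[of 3 3 "int R"] coprime_mult_left_iff[of 2 2 "int R"]
      coprime_mult_left_iff[of 4 3 "int R"] coprime_mult_left_iff[of 3 5 "int R"]
      coprime_mult_left_iff[of 4 5 "int R"] coprime_mult_left_iff[of 5 5 "int R"]
    by (simp_all add: coprime_commute)
  have sq: "usq R 81" "usq R 144" "usq R 225" "usq R 400" "usq R 625"
    using cop[THEN usq_square] by simp_all
  have nsq: "\<not> usq R (-225)" "\<not> usq R (-400)"
    using not_usq_minus[OF q] sq by auto
  note facts = l nl usq_one sq nsq not_usq_0[OF P1] not_usq_0[OF R1]
  \<comment> \<open>The edges use \<open>81 + 144 = 225\<close> and \<open>225 + 400 = 625\<close>.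
    Non-edges either have equal first coordinates or, in the orientation making the first difference
    a square, second difference \<open>0\<close>, \<open>-225\<close> or
    \<open>-400\<close>.\<close>
  show ?thesis
    by (rule not_perfect_walk7[OF n, of "F l 0" "F 0 81" "F 1 225" "F 0 0" "F 1 400"
          "F 0 (-225)" "F 1 (-144)"]; simp del: of_nat_power add: F facts)
qed

section \<open>A prime 1 modulo 4 together with a coprime cofactor\<close>

lemma prime_power_factor:
  assumes "prime (p :: nat)" "p dvd n" "n > 0"
  obtains a R where "a > 0" "n = p ^ a * R" "coprime p R" "R < n" "R > 0"
proof -
  obtain a R where aR: "n = p ^ a * R" "\<not> p dvd R"
    using multiplicity_decompose'[of n p] assms(1,3) not_prime_unit by blast
  have a: "a > 0" using aR assms(2) by (cases a) auto
  have "p ^ a > 1" using a by (intro one_less_power prime_gt_1_nat[OF assms(1)])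
  moreover have "R > 0" using aR assms(3) by (cases R) auto
  ultimately have "R < n" using aR(1) by simp
  thus ?thesis using that a aR prime_imp_coprime[OF assms(1)] \<open>R > 0\<close> by blast
qed

text \<open>For \<open>p mod 4 = 3\<close> the sum is \<open>1 + (l - 1) - l\<close>; for
  \<open>p mod 4 = 1\<close>, where \<open>-1\<close> is a residue, it is
  \<open>9 + 16 - 25\<close>.\<close>

lemma usq_zero_sum_prime_power:
  assumes "prime p" "odd p" "p \<noteq> 5"
  obtains s t where "usq (int (p ^ m)) s" "usq (int (p ^ m)) t" "usq (int (p ^ m)) (- (s + t))"
proof -
  have "p mod 4 = 3 \<or> p mod 4 = 1" using assms(2) by presburger
  thus ?thesis
  proof
    assume "p mod 4 = 3"
    then obtain l where "usq (int (p ^ m)) (l - 1)" "usq (int (p ^ m)) (- l)"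
      using consecutive_residues_3_mod_4[OF assms(1)] by blast
    thus ?thesis using that[of 1 "l - 1"] usq_one by simp
  next
    assume 1: "p mod 4 = 1"
    have prime: "prime (int p)" using assms(1) by simp
    have "p \<noteq> 3" "p \<noteq> 2" using 1 by auto
    hence "coprime 3 (int p)" "coprime 5 (int p)" "coprime 4 (int p)"
      using assms primes_coprime[of 3 "int p"] primes_coprime[of 5 "int p"] primes_coprime[of 2 "int p"] prime
        coprime_mult_left_iff[of 2 2 "int p"] by auto
    hence sq: "usq (int p) 9" "usq (int p) 16" "usq (int p) 25"
      using usq_square[of 3 "int p"] usq_square[of 4 "int p"] usq_square[of 5 "int p"] by simp_all
    moreover have "usq (int p) (- 25)"
      using usq_mult_left_iff[OF assms(1,2) sq(3), of "-1"] usq_minus_one_iff[OF assms(1,2)] 1 by simp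
    ultimately show ?thesis
      using that[of 9 16] usq_prime_power[OF assms(1,2)] by (simp del: of_nat_power)
  qed
qed

text \<open>Prime powers are split off one at a time and the summands glued by the Chinese remainder
  theorem. Three unit squares with sum zero are the successive differences along a triangle.\<close>

lemma usq_zero_sum:
  assumes "odd n" "\<not> 5 dvd n"
  shows "\<exists>s t. usq (int n) s \<and> usq (int n) t \<and> usq (int n) (- (s + t))"
  using assms
proof (induction n rule: less_induct)
  case (less n)
  show ?case
  proof (cases "n = 1")
    case True
    thus ?thesis by (simp add: usq_def)
  next
    case False
    then obtain p where p: "prime p" "p dvd n" using prime_factor_nat by blast
    have "n > 0" using less.prems by (cases n) auto
    then obtain a R where aR: "n = p ^ a * R" "coprime p R" "R < n"
      using prime_power_factor[OF p] by metis
    have "odd R" "\<not> 5 dvd R" using less.prems aR(1) by auto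
    then obtain s t where st: "usq R s" "usq R t" "usq R (- (s + t))"
      using less.IH[OF aR(3)] by blast
    have "odd p" "p \<noteq> 5" using p(2) less.prems by (auto dest: dvd_trans)
    then obtain s' t' where st': "usq (int (p ^ a)) s'" "usq (int (p ^ a)) t'" "usq (int (p ^ a)) (- (s' + t'))"
      using usq_zero_sum_prime_power[OF p(1)] by blast
    have cop: "coprime (int (p ^ a)) (int R)" using aR(2) by simp
    obtain x where x: "[x = s'] (mod int (p ^ a))" "[x = s] (mod int R)"
      using binary_chinese_remainder_int[OF cop] by blast
    obtain y where y: "[y = t'] (mod int (p ^ a))" "[y = t] (mod int R)"
      using binary_chinese_remainder_int[OF cop] by blast
    have xy: "[- (x + y) = - (s' + t')] (mod int (p ^ a))" "[- (x + y) = - (s + t)] (mod int R)"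
      using x y by (auto simp only: cong_minus_minus_iff intro: cong_add)
    have "usq (int n) x" "usq (int n) y" "usq (int n) (- (x + y))"
      using usq_coprime_modulus_iff[OF cop] st st' usq_cong[OF x(1)] usq_cong[OF x(2)]
        usq_cong[OF y(1)] usq_cong[OF y(2)] usq_cong[OF xy(1)] usq_cong[OF xy(2)]
      by (simp_all only: aR(1) of_nat_mult)
    thus ?thesis by blast
  qed
qed

text \<open>As \<open>l\<close> is a nonresidue, the last three conclusions say that the residues
  \<open>s1, s2, s3\<close> have pairwise nonresidue differences. The triple is explicit in each
  case.\<close>

lemma nonresidue_triple:
  assumes p: "prime p" "p mod 4 = 1" "p > 5"
    and l: "2 \<le> l" "\<not> int p dvd l" "\<not> usq (int p) l" "\<And>k. 0 < k \<Longrightarrow> k < l \<Longrightarrow> usq (int p) k"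
  obtains s1 s2 s3 where "usq (int p) s1" "usq (int p) s2" "usq (int p) s3"
    "usq (int p) (l * (s1 - s2))" "usq (int p) (l * (s2 - s3))" "usq (int p) (l * (s3 - s1))"
proof -
  have odd: "odd p" using p(2) by presburger
  have prime: "prime (int p)" using p(1) by simp
  have m1: "usq (int p) (-1)" using usq_minus_one_iff[OF p(1) odd] p(2) by simp
  have minus: "usq (int p) (- t)" if "usq (int p) t" for t
    using usq_mult[OF m1 that] by simp
  have cop: "coprime 2 (int p)" "coprime 3 (int p)" "coprime 5 (int p)"
    using odd p(3) prime by (auto intro!: primes_coprime)
  have l2: "usq (int p) (l * l)"
    using usq_nonresidue_mult_left[OF p(1) odd l(2,3), of l] l by blast
  show ?thesis
  proof (cases "l = 2")
    case False
    hence two: "usq (int p) 2" using l by auto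
    \<comment> \<open>Half of \<open>l\<close> or of \<open>l + 1\<close> is a positive integer
      below \<open>l\<close>, hence a residue, and so is \<open>2\<close>. For even \<open>l\<close>
      this would make \<open>l\<close> a residue.\<close>
    have "usq (int p) (l + 1)"
    proof (cases "even l")
      case True
      hence "usq (int p) (2 * (l div 2))" using False l(1) by (intro usq_mult two l(4)) auto
      thus ?thesis using True l(3) by simp
    next
      case False
      hence "usq (int p) (2 * ((l + 1) div 2))" using \<open>l \<noteq> 2\<close> l(1) by (intro usq_mult two l(4)) auto
      moreover have "2 * ((l + 1) div 2) = l + 1" using False by presburger
      ultimately show ?thesis by simp
    qed
    moreover have "usq (int p) (l - 1)" using l by auto
    \<comment> \<open>The differences are \<open>- l\<close>, \<open>- l\<close> and
      \<open>2 * l\<close>.\<close>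
    ultimately show ?thesis
      using that[of "- (l + 1)" "-1" "l - 1"] m1 minus[of "l + 1"] minus[OF l2] usq_mult[OF two l2]
      by (simp add: algebra_simps)
  next
    case True
    have nz: "\<not> int p dvd 3" "\<not> int p dvd 5"
      using p(3) zdvd_imp_le[of "int p" 3] zdvd_imp_le[of "int p" 5] by auto
    have four: "usq (int p) 4" using usq_square[OF cop(1)] by simp
    have sq: "usq (int p) 4" "usq (int p) 9" "usq (int p) 16"
      using four usq_square[OF cop(2)] usq_mult[OF four four] by simp_all
    note two = l(2,3)[unfolded True]
    note two_mult = usq_nonresidue_mult_left[OF p(1) odd two]
    \<comment> \<open>The triples \<open>(1, 3, 9)\<close>, \<open>(1, -1, 4)\<close> and
      \<open>(1, -1, 9)\<close> have differences \<open>(-2, -6, 8)\<close>,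
      \<open>(2, -5, 3)\<close> and \<open>(2, -10, 8)\<close>; with \<open>2\<close> a nonresidue,
      the residue status of \<open>3\<close> and \<open>5\<close> decides which one works.\<close>
    consider "usq (int p) 3" | "\<not> usq (int p) 3" "\<not> usq (int p) 5" | "\<not> usq (int p) 3" "usq (int p) 5"
      by blast
    thus ?thesis
    proof cases
      case 1
      have "usq (int p) (- 12)" using minus[OF usq_mult[OF sq(1) 1]] by simp
      thus ?thesis
        using that[of 1 3 9] usq_one sq 1 minus[OF sq(1)] True by simp
    next
      case 2
      have "usq (int p) 6" using two_mult[of 3] 2 nz by simp
      moreover have "usq (int p) (- 10)" using minus[of "2 * 5"] two_mult[of 5] 2 nz by simp
      ultimately show ?thesis
        using that[of 1 "-1" 4] usq_one m1 sq True by simp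
    next
      case 3
      have "usq (int p) (- 20)" using minus[OF usq_mult[OF sq(1) 3(2)]] by simp
      thus ?thesis
        using that[of 1 "-1" 9] usq_one m1 sq True by simp
    qed
  qed
qed

text \<open>
  Modulo \<open>R\<close> the vertices lie on the triangle \<open>0, t1, t1 + t2\<close>. Modulo \<open>p ^ a\<close>, where adjacency
  means that the difference is a square, the numbers \<open>l * s1, l * s2, l * s3\<close> form a triangle
  avoiding the neighbours of \<open>0\<close>, and \<open>s1\<close> joins it to \<open>0\<close>.
\<close>

lemma not_perfect_prime_1_mod_4_composite:
  assumes p: "prime p" "p mod 4 = 1" "a > 0"
    and R: "coprime p R" "odd R" "R > 1" and five: "\<not> 5 dvd p ^ a * R"
  shows "\<not> perfect_graph (carrier (Zmod (R * p ^ a))) (quc_edges (R * p ^ a))"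
proof -
  let ?Q = "int (p ^ a)"
  have odd: "odd p" using p(2) by presburger
  have Q1: "p ^ a > 1" using p(3) by (intro one_less_power prime_gt_1_nat[OF p(1)])
  have dvd: "int p dvd ?Q" using p(3) by simp
  have "\<not> 5 dvd R" "p \<noteq> 5" using five p(3) by (auto intro: dvd_mult2)
  moreover have "p \<noteq> 0" "p \<noteq> 1" using p(1) by auto
  ultimately have p5: "p > 5" using p(2) by (cases "p \<in> {2, 3, 4}") auto
  obtain t1 t2 where t: "usq R t1" "usq R t2" "usq R (- (t1 + t2))"
    using usq_zero_sum[OF R(2) \<open>\<not> 5 dvd R\<close>] by blast
  obtain l where l: "2 \<le> l" "\<not> int p dvd l" "\<not> usq (int p) l" "\<And>k. 0 < k \<Longrightarrow> k < l \<Longrightarrow> usq (int p) k"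
    using least_nonresidue[OF p(1) odd] by metis
  obtain s1 s2 s3 where s: "usq (int p) s1" "usq (int p) s2" "usq (int p) s3"
    "usq (int p) (l * (s1 - s2))" "usq (int p) (l * (s2 - s3))" "usq (int p) (l * (s3 - s1))"
    using nonresidue_triple[OF p(1,2) p5 l] by metis
  have n: "R * p ^ a > 1" using Q1 R(3) by (metis less_1_mult)
  obtain F where F0: "\<And>x y x' y'. quc_adj (R * p ^ a) (F x y) (F x' y') \<longleftrightarrow>
    usq R (x - x') \<and> usq ?Q (y - y') \<or> usq R (x' - x) \<and> usq ?Q (y' - y)"
    using quc_adj_crt[of R "p ^ a"] R(1) n by (auto simp: coprime_commute)
  have Q: "usq ?Q u \<longleftrightarrow> usq (int p) u" for u
    using usq_prime_power[OF p(1) odd] usq_dvd[OF _ dvd] by blast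
  have m1: "usq (int p) (-1)" using usq_minus_one_iff[OF p(1) odd] p(2) by simp
  have minus: "usq (int p) (- u) \<longleftrightarrow> usq (int p) u" for u
    using usq_mult_left_iff[OF p(1) odd m1, of u] by simp
  have sym: "usq ?Q (y - y') \<longleftrightarrow> usq ?Q (y' - y)" for y y'
    using minus[of "y - y'"] unfolding Q by simp
  \<comment> \<open>Since \<open>-1\<close> is a residue modulo \<open>p\<close>, the second
    difference imposes no orientation, and adjacency splits into independent conditions on the
    coordinates.\<close>
  have F: "quc_adj (R * p ^ a) (F x y) (F x' y') \<longleftrightarrow>
    (usq R (x - x') \<or> usq R (x' - x)) \<and> usq (int p) (y - y')" for x y x' y'
    unfolding F0 using sym Q by blast
  have ls: "\<not> usq (int p) (l * s)" if "usq (int p) s" for s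
    using usq_mult_left_iff[OF p(1) odd that, of l] l(3) by (simp add: mult.commute)
  have "usq (int p) (l - 1)" using l by auto
  hence "usq (int p) ((l - 1) * s1)" using s(1) by (rule usq_mult)
  hence l1: "usq (int p) (l * s1 - s1)" by (simp add: algebra_simps)
  hence l1': "usq (int p) (s1 - l * s1)" using minus[of "l * s1 - s1"] by simp
  have d: "usq (int p) (l * s1 - l * s2)" "usq (int p) (l * s2 - l * s3)" "usq (int p) (l * s3 - l * s1)"
    using s(4-6) by (simp_all add: algebra_simps)
  have n0: "\<not> usq (int p) 0" using not_usq_0[OF prime_gt_1_nat[OF p(1)]] .
  have t3: "usq R (- t1 - t2)" using t(3) by simp
  note facts = t(1,2) t3 s(1) ls[OF s(1)] ls[OF s(2)] ls[OF s(3)] l1 l1' d minus n0 not_usq_0[OF R(3)]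
  \<comment> \<open>The start has second coordinate \<open>0\<close>, so it is adjacent to the two
    vertices with second coordinate \<open>s1\<close> but to none with a multiple of
    \<open>l\<close>. Those two agree in the second coordinate, hence are not adjacent.\<close>
  show ?thesis
    by (rule not_perfect_walk7[OF n, of "F (t1 + t2) 0" "F 0 s1" "F t1 (l * s1)" "F 0 (l * s2)"
          "F t1 (l * s3)" "F 0 (l * s1)" "F t1 s1"]; simp add: F facts)
qed

section \<open>Powers of a prime 1 modulo 4\<close>

text \<open>
  Let \<open>w\<close> be the clique number of the subgraph induced on \<open>{0..<p}\<close>, a Paley graph, and \<open>l\<close> a
  nonresidue. Multiplication by \<open>l\<close> turns colour classes into cliques, so \<open>p \<le> w\<^sup>2\<close>; for a clique
  \<open>K\<close> the map \<open>(x, y) \<mapsto> x - l y\<close> is injective on \<open>K \<times> K\<close>, so \<open>w\<^sup>2 \<le> p\<close>. But \<open>p\<close> is not a square.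
\<close>

lemma not_perfect_1_mod_4_prime_power:
  assumes p: "prime p" "p mod 4 = 1" "a > 0"
  shows "\<not> perfect_graph (carrier (Zmod (p ^ a))) (quc_edges (p ^ a))"
proof
  let ?n = "p ^ a"
  let ?Z = "ZMod (int ?n)"
  let ?I = "{0..<int p}"
  assume perf: "perfect_graph (carrier (Zmod ?n)) (quc_edges ?n)"
  have odd: "odd p" using p(2) by presburger
  have n1: "?n > 1" using p(3) by (intro one_less_power prime_gt_1_nat[OF p(1)])
  have dvd: "int p dvd int ?n" using p(3) by simp
  have p0: "p > 0" using p(1) by (rule prime_gt_0_nat)
  have "usq (int p) (-1)" using usq_minus_one_iff[OF p(1) odd] p(2) by simp
  from usq_mult_left_iff[OF p(1) odd this]
  have minus: "usq (int p) (- u) \<longleftrightarrow> usq (int p) u" for u by simp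
  have "quc_adj ?n x y \<longleftrightarrow> usq (int ?n) (x - y) \<or> usq (int ?n) (y - x)" for x y
    using quc_adjI[OF n1] by (auto simp: quc_adj_def)
  moreover have "usq (int ?n) u \<longleftrightarrow> usq (int p) u" for u
    using usq_prime_power[OF p(1) odd] usq_dvd[OF _ dvd] by blast
  ultimately have edge: "{?Z x, ?Z y} \<in> quc_edges ?n \<longleftrightarrow> usq (int p) (x - y)" for x y
    using minus[of "x - y"] unfolding quc_edges_iff by simp
  obtain l where l: "\<not> int p dvd l" "\<not> usq (int p) l"
    using least_nonresidue[OF p(1) odd] by metis
  have eqI: "x = y" if "x \<in> ?I" "y \<in> ?I" "int p dvd x - y" for x y
    using that mod_eq_dvd_iff[of x "int p" y] by simp
  have Z_eqD: "int p dvd x - y" if "?Z x = ?Z y" for x y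
    using that dvd unfolding ZMod_eq_cong cong_iff_dvd_diff by (rule dvd_trans[rotated])
  have sub: "?Z ` ?I \<subseteq> carrier (Zmod ?n)" by (auto simp: carrier_ZFact)
  obtain K f where K: "K \<subseteq> ?Z ` ?I" "clique K (quc_edges ?n)"
      "proper_colouring (?Z ` ?I) (quc_edges ?n) (card K) f"
    and max: "\<And>K'. K' \<subseteq> ?Z ` ?I \<Longrightarrow> clique K' (quc_edges ?n) \<Longrightarrow> card K' \<le> card K"
    using perfect_graphE[OF perf _ sub quc_edges_no_loop] by blast
  have "card {x \<in> ?I. f (?Z x) = c} \<le> card K" (is "card ?S \<le> _") for c
  proof -
    let ?g = "\<lambda>x. ?Z (l * x mod int p)"
    have sq: "usq (int p) (l * x mod int p - l * y mod int p)" if xy: "x \<in> ?S" "y \<in> ?S" "x \<noteq> y" for x y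
    proof -
      have "?Z x \<in> ?Z ` ?I" "?Z y \<in> ?Z ` ?I" "f (?Z x) = f (?Z y)" using xy by simp_all
      hence "\<not> usq (int p) (x - y)"
        using K(3) unfolding proper_colouring_def edge[symmetric] by blast
      moreover have "\<not> int p dvd x - y" using xy eqI by blast
      ultimately have "usq (int p) (l * (x - y))"
        using usq_nonresidue_mult_left[OF p(1) odd l] by blast
      moreover have "[l * x mod int p - l * y mod int p = l * (x - y)] (mod int p)"
        by (simp add: cong_def mod_diff_eq right_diff_distrib)
      ultimately show ?thesis using usq_cong by blast
    qed
    have inj: "inj_on ?g ?S"
    proof (rule inj_onI, rule ccontr)
      fix x y assume xy: "x \<in> ?S" "y \<in> ?S" "?g x = ?g y" "x \<noteq> y"
      show False using usq_not_dvd[OF p(1) odd sq[OF xy(1,2,4)]] Z_eqD[OF xy(3)] by blast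
    qed
    have "clique (?g ` ?S) (quc_edges ?n)"
      unfolding clique_def
    proof (intro ballI impI)
      fix v w assume "v \<in> ?g ` ?S" "w \<in> ?g ` ?S" and ne: "v \<noteq> w"
      then obtain x y where xy: "x \<in> ?S" "y \<in> ?S" "v = ?g x" "w = ?g y" by blast
      hence "x \<noteq> y" using ne by blast
      thus "{v, w} \<in> quc_edges ?n" using sq xy edge by simp
    qed
    moreover have "?g ` ?S \<subseteq> ?Z ` ?I" using p0 by auto
    ultimately have "card (?g ` ?S) \<le> card K" by (intro max)
    thus ?thesis unfolding card_image[OF inj] .
  qed
  note class_card = this
  have fin: "finite {x \<in> ?I. f (?Z x) = c}" for c
    by (rule finite_subset[of _ ?I]) auto
  have "?I \<subseteq> (\<Union>c<card K. {x \<in> ?I. f (?Z x) = c})"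
    using K(3) by (auto simp: proper_colouring_def)
  hence "card ?I \<le> card (\<Union>c<card K. {x \<in> ?I. f (?Z x) = c})"
    by (rule card_mono[rotated]) (intro finite_UN_I finite_lessThan fin)
  also have "\<dots> \<le> (\<Sum>c<card K. card {x \<in> ?I. f (?Z x) = c})"
    by (rule card_UN_le) simp
  also have "\<dots> \<le> (\<Sum>c<card K. card K)"
    using class_card by (rule sum_mono)
  finally have le: "p \<le> card K * card K" by simp
  \<comment> \<open>\<open>L\<close> consists of integer representatives of the clique, one for each
    vertex.\<close>
  obtain L where L: "L \<subseteq> ?I" "inj_on ?Z L" "K = ?Z ` L"
    using K(1) unfolding subset_image_inj by blast
  have sqL: "usq (int p) (x - y)" if "x \<in> L" "y \<in> L" "x \<noteq> y" for x y
  proof -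
    have "?Z x \<in> K" "?Z y \<in> K" "?Z x \<noteq> ?Z y"
      using that L(3) inj_on_eq_iff[OF L(2)] by simp_all
    thus ?thesis using K(2) unfolding clique_def edge[symmetric] by blast
  qed
  have "inj_on (\<lambda>(x, y). (x - l * y) mod int p) (L \<times> L)"
  proof (rule inj_onI, clarify)
    fix x y x' y' assume xy: "x \<in> L" "y \<in> L" "x' \<in> L" "y' \<in> L"
      and "(x - l * y) mod int p = (x' - l * y') mod int p"
    hence "int p dvd (x - l * y) - (x' - l * y')" by (simp add: mod_eq_dvd_iff)
    hence dvd': "int p dvd (x - x') - l * (y - y')" by (simp add: algebra_simps)
    hence cong: "[x - x' = l * (y - y')] (mod int p)" by (simp add: cong_iff_dvd_diff)
    \<comment> \<open>Otherwise \<open>x - x'\<close> would be congruent to \<open>l\<close> times a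
      residue, a nonzero nonresidue, while differences of distinct elements of \<open>L\<close> are
      residues.\<close>
    have "y = y'"
    proof (rule ccontr)
      assume "y \<noteq> y'"
      hence "usq (int p) (y - y')" using sqL xy by blast
      hence nusq: "\<not> usq (int p) (l * (y - y'))" and ndvd: "\<not> int p dvd l * (y - y')"
        using usq_nonresidue_mult_left[OF p(1) odd l, of "y - y'"] usq_not_dvd[OF p(1) odd, of "y - y'"]
          l(1) p(1) by (simp_all add: prime_dvd_mult_iff)
      have "\<not> usq (int p) (x - x')" using nusq usq_cong[OF cong] by blast
      moreover have "x \<noteq> x'" using ndvd dvd' by (metis diff_0 diff_self dvd_minus_iff)
      ultimately show False using sqL xy by blast
    qed
    moreover have "x = x'"
      using dvd' \<open>y = y'\<close> by (intro eqI subsetD[OF L(1)] xy) simp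
    ultimately show "x = x' \<and> y = y'" by blast
  qed
  hence "card (L \<times> L) \<le> card ?I"
    by (rule card_inj_on_le) (use p0 in auto)
  hence "card K * card K \<le> p"
    using card_image[OF L(2)] L(3) by (simp add: card_cartesian_product)
  hence eq: "p = card K * card K" using le by simp
  hence "card K dvd p" by simp
  hence "card K = 1 \<or> card K = p" using p(1) by (simp add: prime_nat_iff)
  moreover have "p \<noteq> 1 * 1" "p \<noteq> p * p" using prime_gt_1_nat[OF p(1)] by simp_all
  ultimately show False using eq by metis
qed

section \<open>Case distinction on the factorisation of \<open>n\<close>\<close>

theorem theorem12:
  fixes n :: nat
  assumes "n \<ge> 1"
  shows "perfect_graph (carrier (Zmod n)) (quc_edges n) \<longleftrightarrow>
    even n \<or> (\<exists>p m :: nat. prime p \<and> p mod 4 = 3 \<and> n = p ^ m)"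
proof
  assume "even n \<or> (\<exists>p m :: nat. prime p \<and> p mod 4 = 3 \<and> n = p ^ m)"
  thus "perfect_graph (carrier (Zmod n)) (quc_edges n)"
    using perfect_even[OF assms] perfect_3_mod_4_prime_power by blast
next
  assume perf: "perfect_graph (carrier (Zmod n)) (quc_edges n)"
  show "even n \<or> (\<exists>p m :: nat. prime p \<and> p mod 4 = 3 \<and> n = p ^ m)"
  proof (rule ccontr)
    assume neg: "\<not> ?thesis"
    hence odd: "odd n" by blast
    have no5: "\<not> 5 dvd n" using not_perfect_5_dvd[OF odd] perf by blast
    have n0: "n > 0" using assms by simp
    have no_1_mod_4: False if p: "prime p" "p dvd n" "p mod 4 = 1" for p
    proof -
      obtain a R where aR: "a > 0" "n = p ^ a * R" "coprime p R" "R > 0"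
        using prime_power_factor[OF p(1,2) n0] by metis
      show False
      proof (cases "R = 1")
        case True
        hence "n = p ^ a" using aR(2) by simp
        thus False using not_perfect_1_mod_4_prime_power[OF p(1,3) aR(1)] perf by blast
      next
        case False
        hence "R > 1" using aR(4) by simp
        moreover have "odd R" using odd aR(2) by simp
        ultimately show False
          using not_perfect_prime_1_mod_4_composite[OF p(1,3) aR(1,3)] no5 perf
          unfolding aR(2) mult.commute[of "p ^ a" R] by blast
      qed
    qed
    have mod4: "p mod 4 = 3" if "prime p" "p dvd n" for p
    proof -
      have "odd p" using that(2) odd by (auto dest: dvd_trans)
      hence "p mod 4 = 3 \<or> p mod 4 = 1" by presburger
      thus ?thesis using no_1_mod_4 that by blast
    qed
    \<comment> \<open>The modulus \<open>1\<close> falls under the prime powers, as the zeroth power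
      of \<open>3\<close>.\<close>
    have "prime (3::nat)" "(3::nat) mod 4 = 3" by simp_all
    hence "n \<noteq> 3 ^ 0" using neg by blast
    hence "n \<noteq> 1" by simp
    \<comment> \<open>Choosing the least prime factor keeps \<open>3\<close> out of the cofactor
      \<open>R\<close>: a factor \<open>3\<close> would have to be \<open>p\<close> itself, which is
      coprime to \<open>R\<close>. The Pythagorean squares are then units modulo
      \<open>R\<close>.\<close>
    define p where "p = (LEAST p. prime p \<and> p dvd n)"
    have p: "prime p" "p dvd n"
      using LeastI_ex[OF prime_factor_nat[OF \<open>n \<noteq> 1\<close>]] unfolding p_def by blast+
    have least: "p \<le> q" if "prime q" "q dvd n" for q
      unfolding p_def using that by (intro Least_le) blast
    obtain a R where aR: "a > 0" "n = p ^ a * R" "coprime p R"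
      using prime_power_factor[OF p n0] by metis
    have "n \<noteq> p ^ a" using neg mod4[OF p] p(1) by blast
    hence "R \<noteq> 1" using aR(2) by (metis mult.right_neutral)
    then obtain q where q: "prime q" "q dvd R" using prime_factor_nat by blast
    have "\<not> 3 dvd R"
    proof
      assume "3 dvd R"
      hence "p \<le> 3" using least[of 3] aR(2) by simp
      hence "p = 3" using mod4[OF p] by (cases "p = 3") auto
      thus False using \<open>3 dvd R\<close> aR(3) by (simp add: coprime_absorb_left)
    qed
    moreover have "odd R" "\<not> 5 dvd R" using odd no5 unfolding aR(2) by auto
    moreover have "q mod 4 = 3" using mod4 q unfolding aR(2) by simp
    ultimately have "\<not> perfect_graph (carrier (Zmod (p ^ a * R))) (quc_edges (p ^ a * R))"
      using not_perfect_two_primes_3_mod_4[OF p(1) mod4[OF p] aR(1) q(1) _ q(2) aR(3)] by blast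
    thus False using perf unfolding aR(2) by blast
  qed
qed

end
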